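(* Let $k$ be a field of characteristic zero, let $N \ge 1$, let $Y = \begin{bmatrix} a_1 & \cdots & a_N \\ b_1 & \cdots & b_N \end{bmatrix}$ be a $2 \times N$ matrix of indeterminates, and let $\mathrm{SL}_2(k)$ act on $k[Y]$ by $k$-algebra automorphisms, where $M \in \mathrm{SL}_2(k)$ acts by $Y \mapsto MY$. Let $\mathcal{R} \colon k[Y] \to k[Y]^{\mathrm{SL}_2(k)}$ be the Reynolds operator. Give $k[Y]$ the $\mathbb{N}^2$-grading with $\deg(a_i) = (1, 0)$ and $\deg(b_i) = (0, 1)$ for all $1 \le i \le N$. If $\mu \in k[Y]$ is a monomial with $\deg(\mu) = (m, n)$ and $m \ne n$, then $\mathcal{R}(\mu) = 0$.
   Context: The action "$Y \mapsto MY$" means that each entry $[Y]_{ij}$ is sent to $[MY]_{ij}$. The Reynolds operator for the action of $G = \mathrm{SL}_2(k)$ on $S = k[Y]$ is the unique $k$-linear map $\mathcal{R} \colon S \to S^G$ with $\mathcal{R}(r) = r$ for all $r \in S^G$ and $\mathcal{R}(g(s)) = \mathcal{R}(s)$ for all $g \in G$, $s \in S$; it exists and is unique because $\mathrm{SL}_2(k)$ is linearly reductive in characteristic zero, and it is $S^G$-linear. *)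

theory Defs
  imports "HOL-Analysis.Analysis" "HOL-Library.Poly_Mapping"
begin

text \<open>The polynomial ring \<open>'k[x\<^sub>v | v :: 'v]\<close> is the monoid algebra of the exponent vectors
  \<open>'v \<Rightarrow>\<^sub>0 nat\<close>: finitely supported coefficient functions with convolution product.\<close>

type_synonym ('v, 'k) mpoly = "('v \<Rightarrow>\<^sub>0 nat) \<Rightarrow>\<^sub>0 'k"

definition Const :: "'k::comm_ring_1 \<Rightarrow> ('v, 'k) mpoly" where
  "Const c = Poly_Mapping.single 0 c"

definition Var :: "'v \<Rightarrow> ('v, 'k::comm_ring_1) mpoly" where
  "Var v = Poly_Mapping.single (Poly_Mapping.single v 1) 1"

definition pscale :: "'k::comm_ring_1 \<Rightarrow> ('v, 'k) mpoly \<Rightarrow> ('v, 'k) mpoly" where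
  "pscale c p = Const c * p"

definition is_monomial :: "('v, 'k::comm_ring_1) mpoly \<Rightarrow> bool" where
  "is_monomial p \<longleftrightarrow> (\<exists>e. p = (\<Prod>v\<in>Poly_Mapping.keys e. Var v ^ Poly_Mapping.lookup e v))"

text \<open>The algebra endomorphism with \<open>Var v \<mapsto> f v\<close>.\<close>

definition subst :: "('v \<Rightarrow> ('v, 'k::comm_ring_1) mpoly) \<Rightarrow> ('v, 'k) mpoly \<Rightarrow> ('v, 'k) mpoly" where
  "subst f p = (\<Sum>e\<in>Poly_Mapping.keys p.
     Const (Poly_Mapping.lookup p e) * (\<Prod>v\<in>Poly_Mapping.keys e. f v ^ Poly_Mapping.lookup e v))"

text \<open>The indeterminates are the positions of a \<open>2 \<times> N\<close> matrix, with \<open>N = CARD('n)\<close>: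
  \<open>a\<^sub>j = Var (1, j)\<close> and \<open>b\<^sub>j = Var (2, j)\<close>. (The row type \<^typ>\<open>2\<close> has exactly the elements
  \<open>1\<close> and \<open>2\<close>, with \<open>2 = 0\<close>.)\<close>

type_synonym ('n, 'k) kY = "(2 \<times> 'n, 'k) mpoly"

definition Ymat :: "('n::finite, 'k::comm_ring_1) kY ^ 'n ^ 2" where
  "Ymat = (\<chi> i j. Var (i, j))"

definition SL2 :: "('k::comm_ring_1 ^ 2 ^ 2) set" where
  "SL2 = {M. det M = 1}"

definition act :: "'k::comm_ring_1 ^ 2 ^ 2 \<Rightarrow> ('n::finite, 'k) kY \<Rightarrow> ('n, 'k) kY" where
  "act M = subst (\<lambda>(i, j). (map_matrix Const M ** Ymat) $ i $ j)"

definition invariants :: "('n::finite, 'k::comm_ring_1) kY set" where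
  "invariants = {p. \<forall>M\<in>SL2. act M p = p}"

definition is_reynolds :: "(('n::finite, 'k::field_char_0) kY \<Rightarrow> ('n, 'k) kY) \<Rightarrow> bool" where
  "is_reynolds R \<longleftrightarrow>
     Vector_Spaces.linear pscale pscale R \<and>
     range R \<subseteq> invariants \<and>
     (\<forall>r\<in>invariants. R r = r) \<and>
     (\<forall>M\<in>SL2. \<forall>s. R (act M s) = R s)"

definition bideg :: "((2 \<times> 'n::finite) \<Rightarrow>\<^sub>0 nat) \<Rightarrow> nat \<times> nat" where
  "bideg e = (\<Sum>j\<in>UNIV. Poly_Mapping.lookup e (1, j), \<Sum>j\<in>UNIV. Poly_Mapping.lookup e (2, j))"

definition graded_piece :: "nat \<times> nat \<Rightarrow> ('n::finite, 'k::comm_ring_1) kY set" where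
  "graded_piece d = {p. \<forall>e\<in>Poly_Mapping.keys p. bideg e = d}"

lemma vector_space_pscale: "vector_space (pscale :: 'k::field \<Rightarrow> ('v, 'k) mpoly \<Rightarrow> _)"
  by unfold_locales
    (simp_all add: pscale_def Const_def algebra_simps single_add mult_single flip: mult.assoc)

lemma subst_Var: "subst f (Var v) = f v"
  by (simp add: subst_def Var_def Const_def)

lemma act_Ymat: "act M (Ymat $ i $ j) = (map_matrix Const M ** Ymat) $ i $ j"
  by (simp add: act_def Ymat_def subst_Var)

lemma Var_in_graded_piece:
  "Var (1, j) \<in> graded_piece (1, 0)" "Var (2, j) \<in> graded_piece (0, 1)"
  by (auto simp: graded_piece_def Var_def bideg_def lookup_single when_def)

end

theory Submission
  imports Defs
begin

text \<open>The torus element \<open>diag(t, t\<^sup>-\<^sup>1)\<close> scales a monomial of bidegree \<open>(m, n)\<close> by \<open>t\<^bsup>m-n\<^esup>\<close>, so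
  \<open>\<R>(\<mu>) = t\<^bsup>m-n\<^esup> \<R>(\<mu>)\<close>. In characteristic zero \<open>t = 2\<close> is invertible and not a root of unity,
  which forces \<open>\<R>(\<mu>) = 0\<close> whenever \<open>m \<noteq> n\<close>.\<close>

lemma Const_1: "Const 1 = 1"
  by (simp add: Const_def)

lemma Const_mult: "Const (a * b) = Const a * Const b"
  by (simp add: Const_def mult_single)

lemma Const_power: "Const (a ^ k) = Const a ^ k"
  by (induction k) (simp_all add: Const_1 Const_mult)

lemma Const_prod: "Const (\<Prod>i\<in>A. f i) = (\<Prod>i\<in>A. Const (f i))"
  by (induction A rule: infinite_finite_induct) (simp_all add: Const_1 Const_mult)

lemma Var_power: "Var v ^ k = Poly_Mapping.single (Poly_Mapping.single v k) 1"
  by (induction k) (simp_all add: Var_def mult_single flip: single_add)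

lemma prod_single_1:
  "(\<Prod>i\<in>A. Poly_Mapping.single (f i) 1) = Poly_Mapping.single (\<Sum>i\<in>A. f i) (1 :: 'k::comm_ring_1)"
  by (induction A rule: infinite_finite_induct) (simp_all add: mult_single)

lemma sum_single_lookup:
  "(\<Sum>v\<in>Poly_Mapping.keys e. Poly_Mapping.single v (Poly_Mapping.lookup e v)) = e"
  by (rule poly_mapping_eqI)
    (simp add: lookup_sum lookup_single when_def in_keys_iff)

text \<open>Identifies the products in \<open>is_monomial\<close> with the standard basis vectors of
  the monoid algebra, on which \<open>subst\<close> is easy to evaluate.\<close>

lemma prod_Var_power:
  "(\<Prod>v\<in>Poly_Mapping.keys e. Var v ^ Poly_Mapping.lookup e v) = Poly_Mapping.single e 1"
  by (simp add: Var_power prod_single_1 sum_single_lookup)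

lemma subst_single_1:
  "subst f (Poly_Mapping.single e 1) = (\<Prod>v\<in>Poly_Mapping.keys e. f v ^ Poly_Mapping.lookup e v)"
  by (simp add: subst_def Const_1)

lemma subst_scaled_Var:
  "subst (\<lambda>v. Const (w v) * Var v) (Poly_Mapping.single e 1) =
    pscale (\<Prod>v\<in>Poly_Mapping.keys e. w v ^ Poly_Mapping.lookup e v) (Poly_Mapping.single e 1)"
  by (simp add: subst_single_1 pscale_def power_mult_distrib prod.distrib prod_Var_power
      Const_prod Const_power)

text \<open>Two independent entries replace a unit and its inverse, so the action is computed over
  any commutative ring; \<open>s * t = 1\<close> enters through membership in
  \<open>SL2\<close>.\<close>

definition diag2 :: "'k::comm_ring_1 \<Rightarrow> 'k \<Rightarrow> 'k ^ 2 ^ 2" where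
  "diag2 s t = (\<chi> i j. if i = j then if i = 1 then s else t else 0)"

lemma diag2_in_SL2: "s * t = 1 \<Longrightarrow> diag2 s t \<in> SL2"
  by (simp add: SL2_def det_2 diag2_def)

lemma act_diag2:
  "(act (diag2 s t) :: ('n::finite, 'k::comm_ring_1) kY \<Rightarrow> _) =
    subst (\<lambda>v. Const (if fst v = 1 then s else t) * Var v)"
proof -
  have "(map_matrix Const (diag2 s t) ** (Ymat :: ('n, 'k) kY ^ 'n ^ 2)) $ i $ j =
      Const (if i = 1 then s else t) * Var (i, j)" for i and j :: 'n
    using exhaust_2[of i]
    by (auto simp: matrix_matrix_mult_def map_matrix_def diag2_def Ymat_def sum_2 Const_def)
  then show ?thesis
    by (simp add: act_def case_prod_unfold)
qed

lemma act_diag2_single: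
  assumes "bideg e = (m, n)"
  shows "act (diag2 s t) (Poly_Mapping.single e 1) = pscale (s ^ m * t ^ n) (Poly_Mapping.single e 1)"
proof -
  let ?w = "\<lambda>v. if fst v = 1 then s else t"
  \<comment> \<open>Positions outside the support have exponent 0 and contribute 1. The product over
    the full matrix can then be split by rows: the first yields \<open>s ^ m\<close>, the second
    \<open>t ^ n\<close>.\<close>
  have "(\<Prod>v\<in>Poly_Mapping.keys e. ?w v ^ Poly_Mapping.lookup e v) =
      (\<Prod>v\<in>UNIV. ?w v ^ Poly_Mapping.lookup e v)"
    by (rule prod.mono_neutral_left) (auto simp: in_keys_iff)
  also have "\<dots> = (\<Prod>i\<in>UNIV. \<Prod>j\<in>UNIV. ?w (i, j) ^ Poly_Mapping.lookup e (i, j))"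
    by (simp only: prod.cartesian_product UNIV_Times_UNIV case_prod_eta)
      (simp add: case_prod_unfold)
  also have "\<dots> = s ^ m * t ^ n"
    using assms by (auto simp: UNIV_2 bideg_def simp flip: power_sum)
  finally show ?thesis
    by (simp add: act_diag2 subst_scaled_Var)
qed

text \<open>Characteristic zero makes \<open>of_nat\<close> injective, which reduces the claim to
  natural numbers.\<close>

lemma power_eq_2_char_0: "(2 :: 'k::field_char_0) ^ m = 2 ^ n \<longleftrightarrow> m = n"
proof -
  have "(2 :: 'k) ^ m = 2 ^ n \<longleftrightarrow> (of_nat (2 ^ m) :: 'k) = of_nat (2 ^ n)"
    by simp
  then show ?thesis
    by (simp only: of_nat_eq_iff) simp
qed

theorem theorem7p2:
  fixes R :: "('n::finite, 'k::field_char_0) kY \<Rightarrow> ('n, 'k) kY"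
    and \<mu> :: "('n, 'k) kY"
    and m n :: nat
  assumes "is_reynolds R"
    and "is_monomial \<mu>"
    and "\<mu> \<in> graded_piece (m, n)"
    and "m \<noteq> n"
  shows "R \<mu> = 0"
proof -
  interpret vector_space "pscale :: 'k \<Rightarrow> ('n, 'k) kY \<Rightarrow> _"
    by (rule vector_space_pscale)
  obtain e where \<mu>: "\<mu> = Poly_Mapping.single e 1"
    using assms(2) by (auto simp: is_monomial_def prod_Var_power)
  have e: "bideg e = (m, n)"
    using assms(3) by (simp add: \<mu> graded_piece_def)
  \<comment> \<open>The eigenvalue of \<open>diag2 2 (1 / 2)\<close> on the monomial, that is, 2 to
    the integer power m - n.\<close>
  define c :: 'k where "c = 2 ^ m * (1 / 2) ^ n"
  have "R \<mu> = R (act (diag2 2 (1 / 2)) \<mu>)"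
    using assms(1) by (simp add: is_reynolds_def diag2_in_SL2)
  also have "\<dots> = R (pscale c \<mu>)"
    by (simp add: \<mu> act_diag2_single[OF e] c_def)
  also have "\<dots> = pscale c (R \<mu>)"
    using assms(1) by (simp add: is_reynolds_def Vector_Spaces.linear_iff)
  finally have "pscale c (R \<mu>) = pscale 1 (R \<mu>)"
    by simp
  moreover have "c \<noteq> 1"
    using assms(4) by (simp add: c_def power_one_over field_simps power_eq_2_char_0)
  ultimately show ?thesis
    \<comment> \<open>In a vector space, scaling by two distinct scalars agrees only on the zero
      vector.\<close>
    by (simp only: scale_right_imp_eq scale_cancel_right) simp
qed

end
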